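(* Let $n\ge 1$ and let $f_l(z)=q_nz^n+q_{n-1}z^{n-1}+\cdots+q_1z+q_0$ with $q_n=1$ be a monic left polynomial of degree $n$ over the quaternions $\mathbb{H}$, with coefficients $q_0,\dots,q_{n-1}\in\mathbb{H}$. For a given positive real number $w$, let $M=\max_{1\le i\le n}|q_i|w^i$. Then every zero $z\in\mathbb{H}$ of $f_l$ satisfies $$|z|\ge\frac{|q_0|\,w}{|q_0|+M}.$$
   Context: $\mathbb{H}=\{a+bi+cj+dk: a,b,c,d\in\mathbb{R}\}$ is the skew field of real quaternions, with modulus $|a+bi+cj+dk|=\sqrt{a^2+b^2+c^2+d^2}$. A left quaternionic polynomial has its coefficients to the left of the powers of the variable; it is evaluated at $z\in\mathbb{H}$ as $f_l(z)=\sum_{i=0}^n q_iz^i$ using quaternion multiplication, and a zero of $f_l$ is a $z\in\mathbb{H}$ with $f_l(z)=0$. *)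

theory Defs
  imports "HOL-Analysis.Analysis"
begin

(* Quat a b c d stands for a + b i + c j + d k. *)
datatype quat = Quat (qre: real) (qim1: real) (qim2: real) (qim3: real)

lemma quat_eq_iff: "x = y \<longleftrightarrow> qre x = qre y \<and> qim1 x = qim1 y \<and> qim2 x = qim2 y \<and> qim3 x = qim3 y"
  by (cases x; cases y) simp

instantiation quat :: real_normed_div_algebra
begin

definition "0 = Quat 0 0 0 0"

definition "1 = Quat 1 0 0 0"

definition "x + y = Quat (qre x + qre y) (qim1 x + qim1 y) (qim2 x + qim2 y) (qim3 x + qim3 y)"

definition "- x = Quat (- qre x) (- qim1 x) (- qim2 x) (- qim3 x)"

definition "x - y = Quat (qre x - qre y) (qim1 x - qim1 y) (qim2 x - qim2 y) (qim3 x - qim3 y)"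

definition "scaleR r x = Quat (r * qre x) (r * qim1 x) (r * qim2 x) (r * qim3 x)"

definition "x * y =
  Quat (qre x * qre y - qim1 x * qim1 y - qim2 x * qim2 y - qim3 x * qim3 y)
       (qre x * qim1 y + qim1 x * qre y + qim2 x * qim3 y - qim3 x * qim2 y)
       (qre x * qim2 y - qim1 x * qim3 y + qim2 x * qre y + qim3 x * qim1 y)
       (qre x * qim3 y + qim1 x * qim2 y - qim2 x * qim1 y + qim3 x * qre y)"

definition "norm x = sqrt ((qre x)\<^sup>2 + (qim1 x)\<^sup>2 + (qim2 x)\<^sup>2 + (qim3 x)\<^sup>2)"

definition "inverse x =
  scaleR (inverse ((qre x)\<^sup>2 + (qim1 x)\<^sup>2 + (qim2 x)\<^sup>2 + (qim3 x)\<^sup>2))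
    (Quat (qre x) (- qim1 x) (- qim2 x) (- qim3 x))"

definition "x div y = x * inverse (y :: quat)"

definition "sgn x = scaleR (inverse (norm x)) (x :: quat)"

definition "dist x y = norm (x - y :: quat)"

definition [code del]: "uniformity = (INF e\<in>{0<..}. principal {(x :: quat, y). dist x y < e})"

definition [code del]:
  "open (U :: quat set) \<longleftrightarrow> (\<forall>x\<in>U. eventually (\<lambda>(x', y). x' = x \<longrightarrow> y \<in> U) uniformity)"

lemmas quat_arith_defs = zero_quat_def one_quat_def plus_quat_def uminus_quat_def minus_quat_def
  scaleR_quat_def times_quat_def

instance
proof
  fix x y z :: quat and r s :: real
  show "x + y + z = x + (y + z)" "x + y = y + x" "0 + x = x" "- x + x = 0" "x - y = x + - y"
    by (simp_all add: quat_arith_defs)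
  show "r *\<^sub>R (x + y) = r *\<^sub>R x + r *\<^sub>R y" "(r + s) *\<^sub>R x = r *\<^sub>R x + s *\<^sub>R x"
    "r *\<^sub>R s *\<^sub>R x = (r * s) *\<^sub>R x" "1 *\<^sub>R x = x"
    by (simp_all add: quat_arith_defs algebra_simps)
  show "x * y * z = x * (y * z)" "(x + y) * z = x * z + y * z" "x * (y + z) = x * y + x * z"
    "1 * x = x" "x * 1 = x" "(0::quat) \<noteq> 1"
    "r *\<^sub>R x * y = r *\<^sub>R (x * y)" "x * r *\<^sub>R y = r *\<^sub>R (x * y)"
    by (simp_all add: quat_arith_defs algebra_simps)
  have pos: "(qre x)\<^sup>2 + (qim1 x)\<^sup>2 + (qim2 x)\<^sup>2 + (qim3 x)\<^sup>2 = 0 \<longleftrightarrow> x = 0"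
    by (simp add: add_nonneg_eq_0_iff quat_eq_iff zero_quat_def)
  show "norm x = 0 \<longleftrightarrow> x = 0"
    by (simp add: norm_quat_def pos)
  have inv: "u * u * t + v * v * t + p * p * t + q * q * t = 1"
    if "u\<^sup>2 + v\<^sup>2 + p\<^sup>2 + q\<^sup>2 \<noteq> 0" "t = inverse (u\<^sup>2 + v\<^sup>2 + p\<^sup>2 + q\<^sup>2)"
    for u v p q t :: real
  proof -
    have "(u\<^sup>2 + v\<^sup>2 + p\<^sup>2 + q\<^sup>2) * t = 1" using that by simp
    then show ?thesis by (simp add: power2_eq_square algebra_simps)
  qed
  show "inverse x * x = 1" if "x \<noteq> 0"
    using inv[of "qre x" "qim1 x" "qim2 x" "qim3 x", OF _ refl] that pos
    by (simp add: inverse_quat_def one_quat_def times_quat_def scaleR_quat_def)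
       (simp add: algebra_simps)
  show "x * inverse x = 1" if "x \<noteq> 0"
    using inv[of "qre x" "qim1 x" "qim2 x" "qim3 x", OF _ refl] that pos
    by (simp add: inverse_quat_def one_quat_def times_quat_def scaleR_quat_def)
       (simp add: algebra_simps)
  show "x div y = x * inverse y" by (simp add: divide_quat_def)
  show "inverse (0::quat) = 0" by (simp add: inverse_quat_def scaleR_quat_def zero_quat_def)
  have norm_pair: "norm u = norm (Complex (qre u) (qim1 u), Complex (qim2 u) (qim3 u))" for u :: quat
    by (simp add: norm_quat_def norm_Pair cmod_power2 add.assoc)
  show "norm (x + y) \<le> norm x + norm y"
    unfolding norm_pair
    using norm_triangle_ineq[of "(Complex (qre x) (qim1 x), Complex (qim2 x) (qim3 x))"
        "(Complex (qre y) (qim1 y), Complex (qim2 y) (qim3 y))"]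
    by (simp add: plus_quat_def complex_add)
  show "norm (r *\<^sub>R x) = \<bar>r\<bar> * norm x"
    by (simp add: norm_quat_def scaleR_quat_def power_mult_distrib
        flip: distrib_left real_sqrt_abs real_sqrt_mult)
  show "norm (x * y) = norm x * norm y"
    unfolding norm_quat_def real_sqrt_mult[symmetric]
    by (rule arg_cong[where f = sqrt]) (simp add: times_quat_def power2_eq_square algebra_simps)
  show "sgn x = inverse (norm x) *\<^sub>R x" by (rule sgn_quat_def)
  show "dist x y = norm (x - y)" by (rule dist_quat_def)
  show "open U \<longleftrightarrow> (\<forall>x\<in>U. \<forall>\<^sub>F (x', y) in uniformity. x' = x \<longrightarrow> y \<in> U)" for U :: "quat set"
    by (rule open_quat_def)
  show "(uniformity :: (quat \<times> quat) filter) = (INF e\<in>{0<..}. principal {(x, y). dist x y < e})"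
    by (rule uniformity_quat_def)
qed

end

lemma quat_units:
  defines "qi \<equiv> Quat 0 1 0 0" and "qj \<equiv> Quat 0 0 1 0" and "qk \<equiv> Quat 0 0 0 1"
  shows "qi * qi = -1" "qj * qj = -1" "qk * qk = -1" "qi * qj * qk = -1"
    and "Quat a b c d = of_real a + b *\<^sub>R qi + c *\<^sub>R qj + d *\<^sub>R qk"
  by (simp_all add: qi_def qj_def qk_def of_real_def quat_arith_defs)

(* Evaluation poly of the library's polynomials needs commuting coefficients, so a left polynomial
   of degree at most n is given by its coefficient function q, of which only q 0, ..., q n matter. *)
definition left_eval :: "(nat \<Rightarrow> quat) \<Rightarrow> nat \<Rightarrow> quat \<Rightarrow> quat" where
  "left_eval q n z = (\<Sum>i\<le>n. q i * z ^ i)"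

end

theory Submission
  imports Defs
begin

text \<open>At a zero $z$ the constant term is $-\sum_{i\ge 1} q_i z^i$, so with $t = |z|/w$ we get
  $|q_0| \le M (t + t^2 + \cdots + t^n)$. For $t < 1$ the geometric sum is at most $t/(1-t)$, which
  rearranges to $|q_0| \le (|q_0| + M)\,t$; for $t \ge 1$ the bound is trivial.\<close>

text \<open>Pulling out one factor \<open>t\<close> leaves a sum that telescopes against
  \<open>1 - t\<close>, giving \<open>t * (1 - t ^ n)\<close>. Keeping \<open>1 - t\<close> as a
  factor instead of dividing by it covers every \<open>t\<close> \<ge> 0.\<close>

lemma one_minus_times_geometric_sum_le:
  fixes t :: real
  assumes "0 \<le> t"
  shows "(1 - t) * (\<Sum>i=1..n. t ^ i) \<le> t"
proof -
  have "(\<Sum>i=1..n. t ^ i) = t * (\<Sum>i<n. t ^ i)"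
    by (simp add: sum_distrib_left sum.atLeast1_atMost_eq)
  then have "(1 - t) * (\<Sum>i=1..n. t ^ i) = t * (1 - t ^ n)"
    by (simp add: one_diff_power_eq)
  also have "\<dots> \<le> t * 1"
    using assms by (intro mult_left_mono) auto
  finally show ?thesis
    by simp
qed

text \<open>Isolate the constant term and apply the triangle inequality; the quaternion norm is
  multiplicative, so each summand splits exactly.\<close>

lemma left_eval_zero_imp_norm_const_le:
  assumes "left_eval q n z = 0"
  shows "norm (q 0) \<le> (\<Sum>i=1..n. norm (q i) * norm z ^ i)"
proof -
  have "q 0 = - (\<Sum>i=1..n. q i * z ^ i)"
    using assms
    by (simp add: left_eval_def sum.atMost_shift sum.atLeast1_atMost_eq eq_neg_iff_add_eq_0)
  then have "norm (q 0) \<le> (\<Sum>i=1..n. norm (q i * z ^ i))"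
    by (simp only: norm_minus_cancel norm_sum)
  then show ?thesis
    by (simp add: norm_mult norm_power)
qed

theorem theorem4p2:
  fixes q :: "nat \<Rightarrow> quat" and n :: nat and w M :: real and z :: quat
  assumes "n \<ge> 1"
    and "q n = 1"
    and "w > 0"
    and "M = Max ((\<lambda>i. norm (q i) * w ^ i) ` {1..n})"
    and "left_eval q n z = 0"
  shows "norm z \<ge> norm (q 0) * w / (norm (q 0) + M)"
proof -
  define t where "t = norm z / w"
  have z: "norm z = t * w" and t: "0 \<le> t"
    using \<open>w > 0\<close> by (auto simp: t_def)
  have M: "norm (q i) * w ^ i \<le> M" if "i \<in> {1..n}" for i
    using that unfolding assms(4) by (intro Max_ge) auto
  \<comment> \<open>The monic leading term, one of the candidates for the maximum, forces
    \<open>M > 0\<close>, so the denominator \<open>norm (q 0) + M\<close> is positive even when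
    \<open>q 0 = 0\<close>.\<close>
  have "0 < norm (q n) * w ^ n"
    using assms(2,3) by simp
  also have "\<dots> \<le> M"
    using M assms(1) by simp
  finally have "M > 0" .
  have "norm (q 0) \<le> (norm (q 0) + M) * t"
  proof (cases "t < 1")
    case True
    \<comment> \<open>Writing \<open>norm z\<close> as \<open>t * w\<close> exposes the weights
      \<open>norm (q i) * w ^ i\<close> that \<open>M\<close> bounds.\<close>
    have "norm (q 0) \<le> (\<Sum>i=1..n. norm (q i) * w ^ i * t ^ i)"
      using left_eval_zero_imp_norm_const_le[OF assms(5)]
      by (simp add: z power_mult_distrib mult_ac)
    also have "\<dots> \<le> (\<Sum>i=1..n. M * t ^ i)"
      using M t by (intro sum_mono mult_right_mono) auto
    finally have "norm (q 0) \<le> M * (\<Sum>i=1..n. t ^ i)"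
      by (simp only: sum_distrib_left)
    then have "(1 - t) * norm (q 0) \<le> (1 - t) * (M * (\<Sum>i=1..n. t ^ i))"
      using True by (intro mult_left_mono) auto
    also have "\<dots> = M * ((1 - t) * (\<Sum>i=1..n. t ^ i))"
      by (simp only: mult_ac)
    also have "\<dots> \<le> M * t"
      using \<open>M > 0\<close> one_minus_times_geometric_sum_le[OF t] by simp
    finally show ?thesis
      by (simp add: algebra_simps)
  next
    case False
    have "norm (q 0) \<le> (norm (q 0) + M) * 1"
      using \<open>M > 0\<close> by simp
    also have "\<dots> \<le> (norm (q 0) + M) * t"
      using \<open>M > 0\<close> False by (intro mult_left_mono) auto
    finally show ?thesis .
  qed
  \<comment> \<open>Scaling by \<open>w\<close> turns \<open>t\<close> back into
    \<open>norm z\<close>.\<close>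
  then have "norm (q 0) * w \<le> (norm (q 0) + M) * t * w"
    using \<open>w > 0\<close> by simp
  moreover have "norm (q 0) + M > 0"
    using \<open>M > 0\<close> by (simp add: add_nonneg_pos)
  ultimately show ?thesis
    by (simp add: z pos_divide_le_eq mult_ac)
qed

end
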